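(* Let $M$ and $N$ be matroids and let $f: M \rightarrow N$ be a matroid homomorphism such that $f^{-1}(x)$ is a series class of $M$ for each $x \in E(N)$. Then $\mathcal{C}' := \{ f(C) \mid C \in \mathcal{C}(M)\}$ is the set of circuits of a matroid $H$ on the ground set $E(N)$, and $f^{-1}(C') \in \mathcal{C}(M)$ for every $C' \in \mathcal{C}' = \mathcal{C}(H)$; that is, the map $f: E(M) \rightarrow E(N) = E(H)$ is a matroid homeomorphism from $M$ onto $H$.
   Context: For a matroid $X$, $E(X)$ denotes its ground set and $\mathcal{C}(X)$ its set of circuits. A matroid homomorphism $f: M \rightarrow N$ is a map $f: E(M) \rightarrow E(N)$ from the ground set of $M$ onto the ground set of $N$ such that $f(C) \in \mathcal{C}(N)$ for every $C \in \mathcal{C}(M)$. A homomorphism $f: M \rightarrow N$ is a homeomorphism if in addition $f^{-1}(D) \in \mathcal{C}(M)$ for every $D \in \mathcal{C}(N)$. A set $S \subseteq E(M)$ is called a series class of $M$ if its elements are pairwise in series, i.e., every circuit of $M$ that meets $S$ contains $S$. *)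

theory Defs
  imports Main
begin

record 'a matroid_data =
  ground :: "'a set"
  indep :: "'a set \<Rightarrow> bool"

locale matroid =
  fixes M :: "'a matroid_data"
  assumes ground_finite: "finite (ground M)"
    and indep_subset_ground: "indep M X \<Longrightarrow> X \<subseteq> ground M"
    and indep_empty: "indep M {}"
    and indep_subset: "indep M X \<Longrightarrow> Y \<subseteq> X \<Longrightarrow> indep M Y"
    and augment: "indep M X \<Longrightarrow> indep M Y \<Longrightarrow> card X < card Y
      \<Longrightarrow> \<exists>y \<in> Y - X. indep M (insert y X)"

definition circuits :: "'a matroid_data \<Rightarrow> 'a set set" where
  "circuits M = {C. C \<subseteq> ground M \<and> \<not> indep M C \<and> (\<forall>X. X \<subset> C \<longrightarrow> indep M X)}"

text \<open>A map of ground sets is a total function of which only the values on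
  \<^term>\<open>ground M\<close> matter; hence preimages are cut down to \<^term>\<open>ground M\<close>.\<close>

definition preim :: "('a \<Rightarrow> 'b) \<Rightarrow> 'a matroid_data \<Rightarrow> 'b set \<Rightarrow> 'a set" where
  "preim f M D = f -` D \<inter> ground M"

definition matroid_hom :: "('a \<Rightarrow> 'b) \<Rightarrow> 'a matroid_data \<Rightarrow> 'b matroid_data \<Rightarrow> bool" where
  "matroid_hom f M N \<longleftrightarrow> f ` ground M = ground N \<and> (\<forall>C \<in> circuits M. f ` C \<in> circuits N)"

definition matroid_homeo :: "('a \<Rightarrow> 'b) \<Rightarrow> 'a matroid_data \<Rightarrow> 'b matroid_data \<Rightarrow> bool" where
  "matroid_homeo f M N \<longleftrightarrow> matroid_hom f M N \<and> (\<forall>D \<in> circuits N. preim f M D \<in> circuits M)"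

definition series_class :: "'a matroid_data \<Rightarrow> 'a set \<Rightarrow> bool" where
  "series_class M S \<longleftrightarrow>
     S \<subseteq> ground M \<and> (\<forall>C \<in> circuits M. C \<inter> S \<noteq> {} \<longrightarrow> S \<subseteq> C)"

end

theory Submission
  imports Defs
begin

text \<open>
  The independent sets of \<open>H\<close> are the sets \<open>I \<subseteq> E(N)\<close> whose preimage is independent in \<open>M\<close>.
  Since the fibres of \<open>f\<close> are series classes, every circuit of \<open>M\<close> is a union of fibres.
  Choose a section \<open>s\<close> of \<open>f\<close> and let \<open>T\<close> be the complement of its image in \<open>E(M)\<close>.
  A circuit contained in \<open>s(I) \<union> T\<close> only meets fibres over \<open>I\<close>, so \<open>I\<close> is independent in \<open>H\<close> iff
  \<open>s(I) \<union> T\<close> is independent in \<open>M\<close>; that is, \<open>H\<close> is isomorphic to the contraction \<open>M/T\<close>,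
  and augmentation in \<open>H\<close> follows from augmentation in \<open>M\<close>.
\<close>

text \<open>Lets independence of two sets be compared circuit by circuit. A dependent set that is
  not a circuit has a dependent proper subset, and this descent stops by finiteness.\<close>

lemma (in matroid) indep_iff_no_circuit:
  assumes "X \<subseteq> ground M"
  shows "indep M X \<longleftrightarrow> (\<forall>C \<in> circuits M. \<not> C \<subseteq> X)"
proof
  assume "indep M X"
  then show "\<forall>C \<in> circuits M. \<not> C \<subseteq> X"
    using indep_subset by (auto simp: circuits_def)
next
  have "finite X"
    using assms ground_finite finite_subset by blast
  then have "\<not> indep M X \<Longrightarrow> \<exists>C \<in> circuits M. C \<subseteq> X"
    using assms
  proof (induction X rule: finite_psubset_induct)
    case (psubset X)
    show ?case
    proof (cases "X \<in> circuits M")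
      case False
      then obtain Y where "Y \<subset> X" "\<not> indep M Y"
        using psubset.prems by (auto simp: circuits_def)
      then obtain C where "C \<in> circuits M" "C \<subseteq> Y"
        using psubset.IH[of Y] psubset.prems by blast
      then show ?thesis
        using \<open>Y \<subset> X\<close> by blast
    qed blast
  qed
  then show "\<forall>C \<in> circuits M. \<not> C \<subseteq> X \<Longrightarrow> indep M X"
    by blast
qed

lemma circuit_subset_ground: "C \<in> circuits M \<Longrightarrow> C \<subseteq> ground M"
  by (simp add: circuits_def)

lemma preim_subset_ground: "preim f M D \<subseteq> ground M"
  by (simp add: preim_def)

text \<open>Stating independence by preimages instead of as \<open>M\<close>/\<open>T\<close> keeps
  the choice of a section out of the definition; a section enters only in the proof of
  augmentation.\<close>

definition image_matroid :: "('a \<Rightarrow> 'b) \<Rightarrow> 'a matroid_data \<Rightarrow> 'b matroid_data" where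
  "image_matroid f M =
     \<lparr>ground = f ` ground M, indep = \<lambda>I. I \<subseteq> f ` ground M \<and> indep M (preim f M I)\<rparr>"

lemma ground_image_matroid [simp]: "ground (image_matroid f M) = f ` ground M"
  by (simp add: image_matroid_def)

lemma indep_image_matroid [simp]:
  "indep (image_matroid f M) I \<longleftrightarrow> I \<subseteq> f ` ground M \<and> indep M (preim f M I)"
  by (simp add: image_matroid_def)

locale series_fibres = matroid M for M :: "'a matroid_data" +
  fixes f :: "'a \<Rightarrow> 'b"
  assumes series_class_fibre: "x \<in> f ` ground M \<Longrightarrow> series_class M (preim f M {x})"
begin

lemma circuit_fibre_closed:
  assumes "C \<in> circuits M" "a \<in> C" "b \<in> ground M" "f a = f b"
  shows "b \<in> C"
proof -
  have "a \<in> preim f M {f b}" "b \<in> preim f M {f b}"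
    using assms circuit_subset_ground by (auto simp: preim_def)
  then show ?thesis
    using series_class_fibre[of "f b"] assms by (auto simp: series_class_def)
qed

lemma preim_image_circuit:
  assumes "C \<in> circuits M"
  shows "preim f M (f ` C) = C"
  using assms circuit_fibre_closed[OF assms] circuit_subset_ground[OF assms]
  by (auto simp: preim_def)

text \<open>Augmentation compares cardinalities, and the size of a preimage depends on the sizes of
  the fibres. Trading it for s(I) and \<open>T\<close> leaves one element per point of
  \<open>I\<close> plus a constant.\<close>

lemma indep_preim_iff_section:
  assumes s: "\<And>x. x \<in> f ` ground M \<Longrightarrow> s x \<in> ground M \<and> f (s x) = x"
    and I: "I \<subseteq> f ` ground M"
  shows "indep M (preim f M I) \<longleftrightarrow> indep M (s ` I \<union> (ground M - s ` f ` ground M))"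
    (is "_ \<longleftrightarrow> indep M (s ` I \<union> ?T)")
proof -
  have "C \<subseteq> preim f M I \<longleftrightarrow> C \<subseteq> s ` I \<union> ?T" if C: "C \<in> circuits M" for C
  proof
    assume L: "C \<subseteq> preim f M I"
    show "C \<subseteq> s ` I \<union> ?T"
      using L s by (auto simp: preim_def)
  next
    assume R: "C \<subseteq> s ` I \<union> ?T"
    show "C \<subseteq> preim f M I"
    proof
      fix c assume "c \<in> C"
      then have c: "c \<in> ground M"
        using C circuit_subset_ground by blast
      \<comment> \<open>\<open>C\<close> contains the representative of the fibre of
        \<open>c\<close>; as \<open>T\<close> has no representatives, this one must come from
        \<open>I\<close>.\<close>
      then have "s (f c) \<in> C"
        using circuit_fibre_closed[OF C \<open>c \<in> C\<close>] s by simp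
      then have "s (f c) \<in> s ` I"
        using R c by blast
      then have "f c \<in> I"
        using s I c by (metis imageE imageI subsetD)
      then show "c \<in> preim f M I"
        using c by (simp add: preim_def)
    qed
  qed
  moreover have "s ` I \<union> ?T \<subseteq> ground M"
    using s I by blast
  ultimately show ?thesis
    by (simp add: indep_iff_no_circuit preim_subset_ground)
qed

lemma matroid_image_matroid: "matroid (image_matroid f M)"
proof
  show "finite (ground (image_matroid f M))"
    by (simp add: ground_finite)
  show "indep (image_matroid f M) {}"
    by (simp add: preim_def indep_empty)
  show "X \<subseteq> ground (image_matroid f M)" if "indep (image_matroid f M) X" for X
    using that by simp
  show "indep (image_matroid f M) Y" if "indep (image_matroid f M) X" "Y \<subseteq> X" for X Y
    using that indep_subset[of "preim f M X" "preim f M Y"] by (auto simp: preim_def)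
next
  fix X Y
  assume X: "indep (image_matroid f M) X" and Y: "indep (image_matroid f M) Y"
    and less: "card X < card Y"
  define s where "s = inv_into (ground M) f"
  have s: "s x \<in> ground M \<and> f (s x) = x" if "x \<in> f ` ground M" for x
    using that by (simp add: s_def inv_into_into f_inv_into_f)
  define T where "T = ground M - s ` f ` ground M"
  have card_section: "card (s ` I \<union> T) = card I + card T" if "I \<subseteq> f ` ground M" for I
  proof -
    have "inj_on s I"
      using s that by (metis inj_onI subsetD)
    moreover have "finite I"
      using that ground_finite finite_subset by blast
    moreover have "s ` I \<inter> T = {}"
      using that by (auto simp: T_def)
    ultimately show ?thesis
      by (simp add: card_Un_disjoint card_image T_def ground_finite)
  qed
  have indep_section: "indep M (preim f M I) \<longleftrightarrow> indep M (s ` I \<union> T)"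
    if "I \<subseteq> f ` ground M" for I
    using indep_preim_iff_section[of s I] s that by (simp add: T_def)
  have "card (s ` X \<union> T) < card (s ` Y \<union> T)"
    using X Y less card_section by simp
  then obtain z where z: "z \<in> (s ` Y \<union> T) - (s ` X \<union> T)" "indep M (insert z (s ` X \<union> T))"
    using augment[of "s ` X \<union> T" "s ` Y \<union> T"] X Y indep_section by auto
  \<comment> \<open>\<open>T\<close> is part of the set being enlarged, so the new element
    \<open>z\<close> lies in s(Y).\<close>
  then obtain y where y: "y \<in> Y" "z = s y"
    by blast
  then have "y \<notin> X"
    using z by blast
  moreover have "indep (image_matroid f M) (insert y X)"
    using indep_section[of "insert y X"] X Y y z by auto
  ultimately show "\<exists>y \<in> Y - X. indep (image_matroid f M) (insert y X)"
    using y by blast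
qed

text \<open>A circuit \<open>C\<close> lies in the preimage of \<open>D\<close> iff f(C) lies in
  \<open>D\<close>, so the dependent sets are those containing some f(C). It remains to see that
  each f(C) is minimal.\<close>

lemma circuits_image_matroid: "circuits (image_matroid f M) = {f ` C |C. C \<in> circuits M}"
proof -
  have dep: "\<not> indep M (preim f M (f ` C))" if "C \<in> circuits M" for C
    using that preim_image_circuit by (simp add: circuits_def)
  show ?thesis
  proof (intro equalityI subsetI)
    fix D assume D: "D \<in> circuits (image_matroid f M)"
    then have "\<not> indep M (preim f M D)"
      by (simp add: circuits_def)
    then obtain C where C: "C \<in> circuits M" "C \<subseteq> preim f M D"
      using indep_iff_no_circuit[OF preim_subset_ground] by blast
    then have "f ` C \<subseteq> D"
      by (auto simp: preim_def)
    moreover have "\<not> f ` C \<subset> D"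
      using D dep[OF C(1)] by (auto simp: circuits_def)
    ultimately show "D \<in> {f ` C |C. C \<in> circuits M}"
      using C by blast
  next
    fix D assume "D \<in> {f ` C |C. C \<in> circuits M}"
    then obtain C where C: "C \<in> circuits M" and D: "D = f ` C"
      by blast
    have ground: "D \<subseteq> f ` ground M"
      using C D circuit_subset_ground by blast
    have "indep M (preim f M X)" if X: "X \<subset> D" for X
    proof -
      \<comment> \<open>This makes the inclusion below strict: if the preimage of \<open>X\<close>
        were all of \<open>C\<close>, then \<open>X\<close> would be f(C) =
        \<open>D\<close>.\<close>
      have "f ` preim f M X = X"
        using X ground by (auto simp: preim_def)
      moreover have "preim f M X \<subseteq> preim f M D"
        using X by (auto simp: preim_def)
      ultimately have "preim f M X \<subset> C"
        using X D preim_image_circuit[OF C] by blast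
      then show ?thesis
        using C by (simp add: circuits_def)
    qed
    then show "D \<in> circuits (image_matroid f M)"
      using ground dep[OF C] D by (auto simp: circuits_def)
  qed
qed

end

theorem theorem2:
  fixes M :: "'a matroid_data" and N :: "'b matroid_data" and f :: "'a \<Rightarrow> 'b"
  assumes "matroid M" and "matroid N"
    and "matroid_hom f M N"
    and "\<forall>x \<in> ground N. series_class M (preim f M {x})"
  shows "\<exists>H :: 'b matroid_data. matroid H \<and> ground H = ground N
    \<and> circuits H = {f ` C |C. C \<in> circuits M}
    \<and> (\<forall>C' \<in> circuits H. preim f M C' \<in> circuits M)
    \<and> matroid_homeo f M H"
proof -
  have onto: "f ` ground M = ground N"
    using assms(3) by (simp add: matroid_hom_def)
  interpret matroid M
    by fact
  interpret series_fibres M f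
    using assms(4) onto by unfold_locales simp
  let ?H = "image_matroid f M"
  have preim: "\<forall>D \<in> circuits ?H. preim f M D \<in> circuits M"
    by (auto simp: circuits_image_matroid preim_image_circuit)
  moreover have "matroid_homeo f M ?H"
    using preim by (auto simp: matroid_homeo_def matroid_hom_def circuits_image_matroid)
  ultimately show ?thesis
    using matroid_image_matroid circuits_image_matroid onto
    by (intro exI[of _ ?H]) simp
qed

end
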